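(* Let $\chi_1(y)=\int_0^y\epsilon\,|\log|s/4||^{\alpha}\,ds$ with $\epsilon>0$ and $1/4<\alpha<1/2$, and let $\tilde\chi_2$ be a function of one variable satisfying $$\tilde\chi_2'-2(\chi_1')^2(1+\chi_1)^{-2}-\frac1{16}\tilde\chi_2^2=0 .$$ Let $g$ be the metric on $D$ (defined in the context) whose coefficients in the basis $\{L,\underline{L},\partial_2,\partial_3\}$ are $$g_{L\underline{L}}=-2,\qquad g_{\underline{L}\,\underline{L}}=-t\,\tilde\chi_2,\qquad g_{AB}=\delta_{AB}\,\chi_{1A},\qquad g_{A\underline{L}}=-\tfrac14 x_A\,\chi_{2A}\qquad(A,B\in\{2,3\}),$$ together with their symmetric counterparts, all other coefficients being zero, where $\chi_{12}=1+\chi_1=1/\chi_{13}$, $\chi_{2A}=\chi_{1A}\tilde\chi_2$, and all the functions $\chi_1,\chi_{1A},\chi_{2A},\tilde\chi_2$ are evaluated at $x_1-t$. Then the standard coordinates $(x_0,x_1,x_2,x_3)$, $x_0=t$, satisfy the wave coordinate condition $$\partial_\alpha\big(\sqrt{|g|}\,g^{\alpha\beta}\big)=0,\qquad \beta=0,1,2,3 .$$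
   Context: Coordinates on $\mathbb{R}^{1+3}$ are $(t,x_1,x_2,x_3)$; $L=\partial_t+\partial_{x_1}$, $\underline{L}=\partial_t-\partial_{x_1}$, $\partial_A=\partial_{x_A}$ for $A=2,3$; subscripts $L,\underline{L},2,3$ denote components with respect to these vector fields, e.g. $g_{L\underline{L}}=g(L,\underline{L})$. In the wave coordinate condition, $g^{\alpha\beta}$ is the inverse of the matrix $(g_{\alpha\beta})$ of components in the standard coordinates, $|g|=|\det(g_{\alpha\beta})|$, and the repeated index $\alpha$ is summed over $0,\dots,3$ (this index is unrelated to the exponent $\alpha$ in $\chi_1$). The domain is $$D=\{(t,x):\ (x_1-1)^2H(x_1-1)+x_2^2/4+x_3^2/4<(1-t)^2\},$$ where $H(x_1-1)=1$ when $x_1<1$ and $H(x_1-1)=1/4$ when $x_1>1$. *)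

theory Defs
  imports "HOL-Analysis.Analysis"
begin

text \<open>Points of \<open>\<real>\<^sup>1\<^sup>+\<^sup>3\<close> are vectors \<open>p :: real ^ 4\<close> with \<open>t = p $ 0\<close> and \<open>x\<^sub>i = p $ i\<close>. The index type \<open>4\<close>
  consists of the residues \<open>0, 1, 2, 3\<close>; the library enumerates it as \<open>1, 2, 3, 4\<close>, where
  \<open>(4 :: 4) = 0\<close>.\<close>

abbreviation coord_vec :: "4 \<Rightarrow> real ^ 4" where
  "coord_vec i \<equiv> axis i 1"

definition vecL :: "real ^ 4" where
  "vecL = coord_vec 0 + coord_vec 1"

definition vecLbar :: "real ^ 4" where
  "vecLbar = coord_vec 0 - coord_vec 1"

text \<open>The value of \<open>H\<close> at \<open>x\<^sub>1 = 1\<close> is irrelevant, as it is multiplied by \<open>(x\<^sub>1 - 1)\<^sup>2\<close>.\<close>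

definition domD :: "(real ^ 4) set" where
  "domD = {p. (p $ 1 - 1)\<^sup>2 * (if p $ 1 < 1 then 1 else 1/4) + (p $ 2)\<^sup>2 / 4 + (p $ 3)\<^sup>2 / 4
              < (1 - p $ 0)\<^sup>2}"

text \<open>The interval integral is oriented, so this is also the usual
  \<open>- \<integral>\<^sub>y\<^sup>0\<close> for negative \<open>y\<close>.\<close>

definition chi1 :: "real \<Rightarrow> real \<Rightarrow> real \<Rightarrow> real" where
  "chi1 \<epsilon> \<alpha> y = (LBINT s=ereal 0..ereal y. \<epsilon> * \<bar>ln \<bar>s / 4\<bar>\<bar> powr \<alpha>)"

definition chi1A :: "real \<Rightarrow> real \<Rightarrow> 4 \<Rightarrow> real \<Rightarrow> real" where
  "chi1A \<epsilon> \<alpha> A y = (if A = 2 then 1 + chi1 \<epsilon> \<alpha> y else 1 / (1 + chi1 \<epsilon> \<alpha> y))"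

definition chi2A :: "real \<Rightarrow> real \<Rightarrow> (real \<Rightarrow> real) \<Rightarrow> 4 \<Rightarrow> real \<Rightarrow> real" where
  "chi2A \<epsilon> \<alpha> chi2 A y = chi1A \<epsilon> \<alpha> A y * chi2 y"

definition solves_ode_on :: "real \<Rightarrow> real \<Rightarrow> real set \<Rightarrow> (real \<Rightarrow> real) \<Rightarrow> bool" where
  "solves_ode_on \<epsilon> \<alpha> I chi2 \<longleftrightarrow>
     (\<forall>y\<in>I. chi2 differentiable at y \<and>
        deriv chi2 y - 2 * (deriv (chi1 \<epsilon> \<alpha>) y)\<^sup>2 * (1 + chi1 \<epsilon> \<alpha> y) powi (-2)
          - 1/16 * (chi2 y)\<^sup>2 = 0)"

text \<open>A metric is a field \<open>g\<close> of symmetric bilinear forms; the values on the frame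
  \<open>L, Lbar, \<partial>\<^sub>2, \<partial>\<^sub>3\<close> determine \<open>g p\<close> completely.\<close>

definition has_frame_coefficients ::
  "real \<Rightarrow> real \<Rightarrow> (real \<Rightarrow> real) \<Rightarrow> (real ^ 4 \<Rightarrow> real ^ 4 \<Rightarrow> real ^ 4 \<Rightarrow> real) \<Rightarrow> real ^ 4 \<Rightarrow> bool" where
  "has_frame_coefficients \<epsilon> \<alpha> chi2 g p \<longleftrightarrow>
     bilinear (g p) \<and> (\<forall>v w. g p v w = g p w v) \<and>
     g p vecL vecLbar = -2 \<and>
     g p vecLbar vecLbar = - (p $ 0) * chi2 (p $ 1 - p $ 0) \<and>
     (\<forall>A\<in>{2, 3}. \<forall>B\<in>{2, 3}. g p (coord_vec A) (coord_vec B) =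
        (if A = B then chi1A \<epsilon> \<alpha> A (p $ 1 - p $ 0) else 0)) \<and>
     (\<forall>A\<in>{2, 3}. g p (coord_vec A) vecLbar = - 1/4 * p $ A * chi2A \<epsilon> \<alpha> chi2 A (p $ 1 - p $ 0)) \<and>
     g p vecL vecL = 0 \<and>
     (\<forall>A\<in>{2, 3}. g p (coord_vec A) vecL = 0)"

definition metric_matrix ::
  "(real ^ 4 \<Rightarrow> real ^ 4 \<Rightarrow> real ^ 4 \<Rightarrow> real) \<Rightarrow> real ^ 4 \<Rightarrow> real ^ 4 ^ 4" where
  "metric_matrix g p = (\<chi> a b. g p (coord_vec a) (coord_vec b))"

definition has_partial_derivative :: "(real ^ 4 \<Rightarrow> real) \<Rightarrow> 4 \<Rightarrow> real \<Rightarrow> real ^ 4 \<Rightarrow> bool" where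
  "has_partial_derivative f a d p \<longleftrightarrow>
     ((\<lambda>s. f (p + s *\<^sub>R coord_vec a)) has_real_derivative d) (at 0)"

text \<open>The condition includes the existence of the partial derivatives.\<close>

definition wave_coordinate_condition ::
  "(real ^ 4 \<Rightarrow> real ^ 4 \<Rightarrow> real ^ 4 \<Rightarrow> real) \<Rightarrow> real ^ 4 \<Rightarrow> bool" where
  "wave_coordinate_condition g p \<longleftrightarrow>
     (\<forall>b. \<exists>d.
        (\<forall>a. has_partial_derivative
               (\<lambda>q. sqrt \<bar>det (metric_matrix g q)\<bar> * matrix_inv (metric_matrix g q) $ a $ b) a (d a) p) \<and>
        (\<Sum>a\<in>UNIV. d a) = 0)"

end

theory Submission
  imports Defs
begin

text \<open>Since \<open>g\<^sub>L\<^sub>L = g\<^sub>L\<^sub>A = 0\<close> and \<open>\<chi>\<^sub>1\<^sub>2 \<chi>\<^sub>1\<^sub>3 = 1\<close>, the determinant in standard coordinates is \<open>-1\<close>, so the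
  condition says that the inverse metric is divergence free. With \<open>k = t c / 4\<close> and
  \<open>w\<^sub>A = x\<^sub>A c / 8\<close>, where \<open>c\<close> is the value of \<open>\<chi>\<^sub>2\<close> (with a tilde) at \<open>x\<^sub>1 - t\<close>, the inverse has frame components
  \<open>-1/2\<close> for \<open>L Lbar\<close>, \<open>-w\<^sub>A\<close> for \<open>L A\<close>, \<open>\<delta> / \<chi>\<^sub>1\<^sub>A\<close> for \<open>A B\<close>, and
  \<open>k + \<Sum>\<^sub>A \<chi>\<^sub>1\<^sub>A w\<^sub>A\<^sup>2\<close> for \<open>L L\<close>. As \<open>L\<close> annihilates functions of \<open>x\<^sub>1 - t\<close>, \<open>x\<^sub>2\<close>, \<open>x\<^sub>3\<close>, only the \<open>L\<close> component
  of the divergence is not trivially zero, and it equals \<open>c / 4 - 2 c / 8 = 0\<close>.\<close>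

section \<open>Sums and determinants with indices counted from 0\<close>

lemma UNIV_4_from_0: "(UNIV :: 4 set) = {0, 1, 2, 3}"
  using UNIV_4 by auto

lemma exhaust_4_from_0: "(i :: 4) = 0 \<or> i = 1 \<or> i = 2 \<or> i = 3"
  using UNIV_4_from_0 by auto

lemma sum_4_from_0: "sum f (UNIV :: 4 set) = f 0 + f 1 + f 2 + f 3"
  unfolding UNIV_4_from_0 by (simp add: ac_simps)

lemma det_4_from_0:
  fixes A :: "'a::comm_ring_1^4^4"
  shows "det A =
    A$0$0 * (A$1$1 * A$2$2 * A$3$3 + A$1$2 * A$2$3 * A$3$1 + A$1$3 * A$2$1 * A$3$2
           - A$1$1 * A$2$3 * A$3$2 - A$1$2 * A$2$1 * A$3$3 - A$1$3 * A$2$2 * A$3$1)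
  - A$0$1 * (A$1$0 * A$2$2 * A$3$3 + A$1$2 * A$2$3 * A$3$0 + A$1$3 * A$2$0 * A$3$2
           - A$1$0 * A$2$3 * A$3$2 - A$1$2 * A$2$0 * A$3$3 - A$1$3 * A$2$2 * A$3$0)
  + A$0$2 * (A$1$0 * A$2$1 * A$3$3 + A$1$1 * A$2$3 * A$3$0 + A$1$3 * A$2$0 * A$3$1
           - A$1$0 * A$2$3 * A$3$1 - A$1$1 * A$2$0 * A$3$3 - A$1$3 * A$2$1 * A$3$0)
  - A$0$3 * (A$1$0 * A$2$1 * A$3$2 + A$1$1 * A$2$2 * A$3$0 + A$1$2 * A$2$0 * A$3$1
           - A$1$0 * A$2$2 * A$3$1 - A$1$1 * A$2$0 * A$3$2 - A$1$2 * A$2$1 * A$3$0)"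
proof -
  have f0: "finite {1::4, 2, 3}" "0 \<notin> {1::4, 2, 3}" by auto
  have f1: "finite {2::4, 3}" "1 \<notin> {2::4, 3}" by auto
  have f2: "finite {3::4}" "2 \<notin> {3::4}" by auto
  show ?thesis
    unfolding det_def UNIV_4_from_0
    unfolding sum_over_permutations_insert[OF f0] sum_over_permutations_insert[OF f1]
      sum_over_permutations_insert[OF f2]
    unfolding permutes_sing
    by (simp add: sign_swap_id permutation_swap_id permutation_compose sign_compose swap_id_eq
        algebra_simps)
qed

section \<open>The metric and its inverse in standard coordinates\<close>

definition quad :: "'a \<Rightarrow> 'a \<Rightarrow> 'a \<Rightarrow> 'a \<Rightarrow> 4 \<Rightarrow> 'a" where
  "quad x0 x1 x2 x3 i = (if i = 0 then x0 else if i = 1 then x1 else if i = 2 then x2 else x3)"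

lemma quad_simps [simp]:
  "quad x0 x1 x2 x3 0 = x0" "quad x0 x1 x2 x3 1 = x1"
  "quad x0 x1 x2 x3 2 = x2" "quad x0 x1 x2 x3 3 = x3"
  by (simp_all add: quad_def)

text \<open>Nested \<open>quad\<close> lists the rows: \<open>i\<close> picks the row and
  \<open>j\<close> the entry. The parameters \<open>a\<close>, \<open>b\<close> stand for the two
  factors \<open>chi1A\<close>, and \<open>w\<close>, \<open>z\<close> for the two values
  \<open>x\<^sub>A c / 8\<close>.\<close>

definition coord_metric :: "real \<Rightarrow> real \<Rightarrow> real \<Rightarrow> real \<Rightarrow> real \<Rightarrow> real ^ 4 ^ 4" where
  "coord_metric k a b w z = (\<chi> i j. quad
     (quad (- 1 - k) k (- (a * w)) (- (b * z)))
     (quad k (1 - k) (a * w) (b * z))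
     (quad (- (a * w)) (a * w) a 0)
     (quad (- (b * z)) (b * z) 0 b) i j)"

text \<open>\<open>G\<close> is the \<open>L L\<close> component, so it enters all four entries with
  indices in 0, 1. The entries \<open>b\<close> and \<open>a\<close> are the reciprocals of
  \<open>a\<close> and \<open>b\<close> when \<open>a * b = 1\<close>.\<close>

definition coord_inverse :: "real \<Rightarrow> real \<Rightarrow> real \<Rightarrow> real \<Rightarrow> real \<Rightarrow> real ^ 4 ^ 4" where
  "coord_inverse k a b w z = (let G = k + a * w\<^sup>2 + b * z\<^sup>2 in \<chi> i j. quad
     (quad (G - 1) G (- w) (- z))
     (quad G (G + 1) (- w) (- z))
     (quad (- w) (- w) b 0)
     (quad (- z) (- z) 0 a) i j)"

text \<open>Adding row 1 to row 0 and then column 0 to column 1 clears row 0 except for a leading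
  -1; the remaining 3 by 3 block is upper triangular with diagonal 1, \<open>a\<close>,
  \<open>b\<close>.\<close>

lemma det_coord_metric:
  assumes "a * b = 1"
  shows "det (coord_metric k a b w z) = - 1"
proof -
  have "det (coord_metric k a b w z) = - (a * b)"
    by (simp add: det_4_from_0 coord_metric_def algebra_simps)
  with assms show ?thesis by simp
qed

lemma coord_metric_mult_inverse:
  assumes "a * b = 1"
  shows "coord_metric k a b w z ** coord_inverse k a b w z = mat 1"
proof -
  have ba: "b * a = 1" using assms by (simp add: mult.commute)
  have cancel: "a * (b * u) = u" "b * (a * u) = u" for u
    using assms ba by (simp_all flip: mult.assoc)
  have "(coord_metric k a b w z ** coord_inverse k a b w z) $ i $ j = (mat 1 :: real ^ 4 ^ 4) $ i $ j" for i j
    using exhaust_4_from_0[of i] exhaust_4_from_0[of j] assms ba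
    by (elim disjE) (simp_all add: matrix_matrix_mult_def mat_def sum_4_from_0 coord_metric_def
        coord_inverse_def Let_def algebra_simps power2_eq_square cancel)
  then show ?thesis by (simp add: vec_eq_iff)
qed

lemma matrix_inv_eqI:
  fixes A B :: "real ^ 'n ^ 'n"
  assumes "A ** B = mat 1"
  shows "matrix_inv A = B"
proof -
  have BA: "B ** A = mat 1" using assms by (simp add: matrix_left_right_inverse)
  have inv: "A ** matrix_inv A = mat 1 \<and> matrix_inv A ** A = mat 1"
    unfolding matrix_inv_def by (rule someI_ex) (use assms BA in blast)
  have "matrix_inv A = (B ** A) ** matrix_inv A" by (simp add: BA)
  also have "\<dots> = B ** (A ** matrix_inv A)" by (rule matrix_mul_assoc[symmetric])
  also have "\<dots> = B" by (simp add: inv)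
  finally show ?thesis .
qed

lemma metric_matrix_eq_coord_metric:
  assumes "has_frame_coefficients \<epsilon> \<alpha> chi2 g p"
  shows "metric_matrix g p = (let y = p $ 1 - p $ 0 in
    coord_metric (p $ 0 * chi2 y / 4) (chi1A \<epsilon> \<alpha> 2 y) (chi1A \<epsilon> \<alpha> 3 y)
      (p $ 2 * chi2 y / 8) (p $ 3 * chi2 y / 8))"
proof -
  define y where "y = p $ 1 - p $ 0"
  have bil: "bilinear (g p)" and sym: "\<And>v w. g p v w = g p w v"
    and LM: "g p vecL vecLbar = -2" and MM: "g p vecLbar vecLbar = - (p $ 0) * chi2 y"
    and LL: "g p vecL vecL = 0"
    and AB: "g p (coord_vec 2) (coord_vec 2) = chi1A \<epsilon> \<alpha> 2 y"
      "g p (coord_vec 3) (coord_vec 3) = chi1A \<epsilon> \<alpha> 3 y"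
      "g p (coord_vec 2) (coord_vec 3) = 0" "g p (coord_vec 3) (coord_vec 2) = 0"
    and AM: "g p (coord_vec 2) vecLbar = - 1/4 * p $ 2 * (chi1A \<epsilon> \<alpha> 2 y * chi2 y)"
      "g p (coord_vec 3) vecLbar = - 1/4 * p $ 3 * (chi1A \<epsilon> \<alpha> 3 y * chi2 y)"
    and AL: "g p (coord_vec 2) vecL = 0" "g p (coord_vec 3) vecL = 0"
    using assms unfolding has_frame_coefficients_def y_def chi2A_def by auto
  \<comment> \<open>Bilinear expansion produces mixed terms in both orders, so each mixed value is
    recorded in both.\<close>
  note frame = LM LM[folded sym[of vecLbar vecL]] MM LL AB AM AL
    AM[folded sym[of vecLbar]] AL[folded sym[of vecL]]
  have e: "coord_vec 0 = (1/2) *\<^sub>R (vecL + vecLbar)" "coord_vec 1 = (1/2) *\<^sub>R (vecL - vecLbar)"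
    by (simp_all add: vecL_def vecLbar_def vec_eq_iff axis_def)
  have "metric_matrix g p $ i $ j = coord_metric (p $ 0 * chi2 y / 4) (chi1A \<epsilon> \<alpha> 2 y)
      (chi1A \<epsilon> \<alpha> 3 y) (p $ 2 * chi2 y / 8) (p $ 3 * chi2 y / 8) $ i $ j" for i j
    using exhaust_4_from_0[of i] exhaust_4_from_0[of j]
    by (elim disjE)
      (simp_all add: metric_matrix_def coord_metric_def e bilinear_ladd[OF bil] bilinear_radd[OF bil]
        bilinear_lsub[OF bil] bilinear_rsub[OF bil] bilinear_lmul[OF bil] bilinear_rmul[OF bil]
        frame field_simps)
  then show ?thesis by (simp add: vec_eq_iff y_def Let_def)
qed

section \<open>Differentiability of \<open>chi1\<close> away from 0\<close>

text \<open>The singularity at \<open>a\<close> needs no estimate: moving the upper limit past an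
  interior point \<open>c\<close> does not affect integrability. Either the fundamental theorem of
  calculus applies from base point \<open>c\<close>, or the integral is identically 0 near
  \<open>y\<close>.\<close>

lemma interval_lebesgue_integral_differentiable:
  fixes f :: "real \<Rightarrow> real"
  assumes cont: "continuous_on {a<..} f" and "a < y"
  shows "(\<lambda>x. LBINT s=ereal a..ereal x. f s) differentiable at y"
proof -
  obtain c where c: "a < c" "c < y" using \<open>a < y\<close> dense by blast
  have contc: "continuous_on {c..x} f" for x
    by (rule continuous_on_subset[OF cont]) (use c in auto)
  have intc: "set_integrable lborel {c..x} f" for x
    by (rule borel_integrable_atLeastAtMost'[OF contc])
  have integrable_iff: "set_integrable lborel {a<..<x} f \<longleftrightarrow> set_integrable lborel {a<..<c} f"
    if "c < x" for x
  proof
    assume "set_integrable lborel {a<..<c} f"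
    with intc have "set_integrable lborel ({a<..<c} \<union> {c..x}) f"
      by (intro set_integrable_Un) auto
    then show "set_integrable lborel {a<..<x} f"
      by (rule set_integrable_subset) auto
  next
    assume "set_integrable lborel {a<..<x} f"
    then show "set_integrable lborel {a<..<c} f"
      by (rule set_integrable_subset) (use that in auto)
  qed
  define F where "F x = (LBINT s=ereal a..ereal x. f s)" for x
  have "\<exists>D. (F has_real_derivative D) (at y)"
  proof (cases "set_integrable lborel {a<..<c} f")
    case True
    have F_eq: "F x = F c + integral {c..x} f" if "x > c" for x
    proof -
      have "F c + (LBINT s=ereal c..ereal x. f s) = F x"
        unfolding F_def
        by (rule interval_integral_sum)
          (use c that True integrable_iff[OF that] in
            \<open>simp add: interval_lebesgue_integrable_def min_def max_def\<close>)
      moreover have "(LBINT s=ereal c..ereal x. f s) = integral {c..x} f"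
        by (rule interval_integral_eq_integral) (use intc that in auto)
      ultimately show ?thesis by simp
    qed
    have "((\<lambda>x. integral {c..x} f) has_real_derivative f y) (at y within {c..y + 1})"
      by (rule integral_has_real_derivative) (use contc c in auto)
    then have "((\<lambda>x. integral {c..x} f) has_real_derivative f y) (at y)"
      using c at_within_Icc_at[of c y "y + 1"] by simp
    then have "((\<lambda>x. F c + integral {c..x} f) has_real_derivative f y) (at y)"
      by (auto intro!: derivative_eq_intros)
    then have "(F has_real_derivative f y) (at y)"
      by (rule has_field_derivative_transform_within_open[where S = "{c<..}"])
        (use c F_eq in auto)
    then show ?thesis ..
  next
    \<comment> \<open>The Bochner integral of a non-integrable function is \<open>0\<close>.\<close>
    case False
    have F_eq: "F x = 0" if "x > c" for x
    proof -
      have "\<not> set_integrable lborel {a<..<x} f" using False integrable_iff[OF that] by simp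
      then show ?thesis
        using c that unfolding F_def
        by (simp add: interval_lebesgue_integral_def set_lebesgue_integral_def set_integrable_def
            not_integrable_integral_eq)
    qed
    have "(F has_real_derivative 0) (at y)"
      by (rule has_field_derivative_transform_within_open[where S = "{c<..}" and f = "\<lambda>_. 0"])
        (use c F_eq in auto)
    then show ?thesis ..
  qed
  then show ?thesis
    unfolding F_def real_differentiable_def by blast
qed

text \<open>The integrand is even. This carries differentiability from positive to negative
  arguments.\<close>

lemma chi1_minus: "chi1 \<epsilon> \<alpha> (- y) = - chi1 \<epsilon> \<alpha> y"
proof -
  have "chi1 \<epsilon> \<alpha> (- y) = (LBINT s=ereal y..ereal 0. \<epsilon> * \<bar>ln \<bar>s / 4\<bar>\<bar> powr \<alpha>)"
    unfolding chi1_def by (subst interval_integral_reflect) simp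
  also have "\<dots> = - chi1 \<epsilon> \<alpha> y"
    unfolding chi1_def by (rule interval_integral_endpoints_reverse)
  finally show ?thesis .
qed

lemma chi1_differentiable:
  assumes "\<alpha> > 0" "y \<noteq> 0"
  shows "chi1 \<epsilon> \<alpha> differentiable at y"
proof -
  have pos: "chi1 \<epsilon> \<alpha> differentiable at x" if "x > 0" for x
  proof -
    \<comment> \<open>At \<open>s = 4\<close> the logarithm vanishes; \<open>powr\<close> stays
      continuous there because the exponent is positive.\<close>
    have "continuous_on {0<..} (\<lambda>s. \<epsilon> * \<bar>ln \<bar>s / 4\<bar>\<bar> powr \<alpha>)"
      using \<open>\<alpha> > 0\<close> by (intro continuous_intros continuous_on_powr') auto
    from interval_lebesgue_integral_differentiable[OF this that]
    show ?thesis unfolding chi1_def[abs_def] .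
  qed
  show ?thesis
  proof (cases "y > 0")
    case False
    with \<open>y \<noteq> 0\<close> obtain D where "(chi1 \<epsilon> \<alpha> has_real_derivative D) (at (- y))"
      using pos[of "- y"] by (auto simp: real_differentiable_def)
    then have "((\<lambda>x. chi1 \<epsilon> \<alpha> (- x)) has_real_derivative D * (- 1)) (at y)"
      by (intro DERIV_chain2[where g = uminus]) (auto intro!: derivative_eq_intros)
    from DERIV_minus[OF this] show ?thesis by (auto simp: chi1_minus real_differentiable_def)
  qed (rule pos)
qed

section \<open>The divergence of the inverse metric\<close>

lemma divergence_coord_inverse:
  fixes a b c :: "real \<Rightarrow> real"
  assumes a: "(a has_real_derivative a') (at (p $ 1 - p $ 0))"
    and b: "(b has_real_derivative b') (at (p $ 1 - p $ 0))"
    and c: "(c has_real_derivative c') (at (p $ 1 - p $ 0))"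
  shows "\<exists>d. (\<forall>i. has_partial_derivative (\<lambda>q. let y = q $ 1 - q $ 0 in
      coord_inverse (q $ 0 * c y / 4) (a y) (b y) (q $ 2 * c y / 8) (q $ 3 * c y / 8) $ i $ j)
      i (d i) p) \<and> (\<Sum>i\<in>UNIV. d i) = 0"
proof -
  define y where "y = p $ 1 - p $ 0"
  \<comment> \<open>Along the \<open>t\<close> line the argument \<open>x\<^sub>1 - t\<close>
    decreases at unit speed, along the \<open>x\<^sub>1\<close> line it increases; hence the
    opposite signs.\<close>
  have minus: "((\<lambda>s. h (p $ 1 - (p $ 0 + s))) has_real_derivative - h') (at 0)"
    and plus: "((\<lambda>s. h (p $ 1 + s - p $ 0)) has_real_derivative h') (at 0)"
    if "(h has_real_derivative h') (at (p $ 1 - p $ 0))" for h h'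
  proof -
    have "((\<lambda>s. h (p $ 1 - (p $ 0 + s))) has_real_derivative h' * (- 1)) (at 0)"
      by (rule DERIV_chain2) (use that in \<open>auto intro!: derivative_eq_intros\<close>)
    then show "((\<lambda>s. h (p $ 1 - (p $ 0 + s))) has_real_derivative - h') (at 0)" by simp
    have "((\<lambda>s. h (p $ 1 + s - p $ 0)) has_real_derivative h' * 1) (at 0)"
      by (rule DERIV_chain2) (use that in \<open>auto intro!: derivative_eq_intros\<close>)
    then show "((\<lambda>s. h (p $ 1 + s - p $ 0)) has_real_derivative h') (at 0)" by simp
  qed
  \<comment> \<open>\<open>K\<close> is the \<open>x\<^sub>1\<close> derivative of \<open>G\<close>.
    The \<open>t\<close> derivative is \<open>c y / 4 - K\<close>, the extra term coming from the
    explicit factor \<open>t\<close> in \<open>k\<close>.\<close>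
  define K where "K = p $ 0 * c' / 4
    + (a' * (p $ 2)\<^sup>2 + b' * (p $ 3)\<^sup>2) * (c y)\<^sup>2 / 64
    + (a y * (p $ 2)\<^sup>2 + b y * (p $ 3)\<^sup>2) * (2 * c y * c') / 64"
  \<comment> \<open>Here \<open>j\<close> picks the row and the direction of differentiation is the
    position within it, so each row must sum to 0.\<close>
  define d where "d = quad
    (quad (c y / 4 - K) K (- c y / 8) (- c y / 8))
    (quad (c y / 4 - K) K (- c y / 8) (- c y / 8))
    (quad (p $ 2 * c' / 8) (- (p $ 2 * c' / 8)) 0 0)
    (quad (p $ 3 * c' / 8) (- (p $ 3 * c' / 8)) 0 0) j"
  note derivs = minus[OF a] minus[OF b] minus[OF c] plus[OF a] plus[OF b] plus[OF c]
  have "has_partial_derivative (\<lambda>q. let y = q $ 1 - q $ 0 in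
      coord_inverse (q $ 0 * c y / 4) (a y) (b y) (q $ 2 * c y / 8) (q $ 3 * c y / 8) $ i $ j)
      i (d i) p" for i
    using exhaust_4_from_0[of i] exhaust_4_from_0[of j]
    by (elim disjE)
      (simp_all add: has_partial_derivative_def coord_inverse_def d_def Let_def axis_def K_def y_def,
       (rule DERIV_cong, (rule derivs DERIV_cdivide derivative_intros)+,
         simp add: field_simps power2_eq_square; fail)+)
  moreover have "(\<Sum>i\<in>UNIV. d i) = 0"
    using exhaust_4_from_0[of j] by (elim disjE) (simp_all add: sum_4_from_0 d_def)
  ultimately show ?thesis by blast
qed

section \<open>From the explicit matrices to the field \<open>g\<close>\<close>

lemma open_domD: "open domD"
proof -
  \<comment> \<open>Splitting \<open>x\<^sub>1 - 1\<close> into negative and positive parts absorbs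
    the jump of H, leaving a continuous expression.\<close>
  have "domD = {p. (min (p $ 1 - 1) 0)\<^sup>2 + (max (p $ 1 - 1) 0)\<^sup>2 / 4 + (p $ 2)\<^sup>2 / 4 + (p $ 3)\<^sup>2 / 4
      < (1 - p $ 0)\<^sup>2}"
    unfolding domD_def by (intro Collect_cong) (auto simp: min_def max_def)
  also have "open \<dots>"
    by (intro open_Collect_less continuous_intros) auto
  finally show ?thesis .
qed

text \<open>The coordinate line through \<open>p\<close> stays in \<open>U\<close> for small
  parameters, so agreement on \<open>U\<close> suffices.\<close>

lemma has_partial_derivative_transform_open:
  assumes "has_partial_derivative f i d p" "open U" "p \<in> U" "\<And>q. q \<in> U \<Longrightarrow> f q = h q"
  shows "has_partial_derivative h i d p"
proof -
  have "open ((\<lambda>s. p + s *\<^sub>R coord_vec i) -` U)"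
    by (intro open_vimage \<open>open U\<close> continuous_intros)
  then show ?thesis
    using assms unfolding has_partial_derivative_def
    by (elim has_field_derivative_transform_within_open) auto
qed

theorem lemma3p4:
  fixes \<epsilon> \<alpha> :: real
    and chi2 :: "real \<Rightarrow> real"
    and I :: "real set"
    and g :: "real ^ 4 \<Rightarrow> real ^ 4 \<Rightarrow> real ^ 4 \<Rightarrow> real"
  assumes "\<epsilon> > 0" and "1/4 < \<alpha>" and "\<alpha> < 1/2"
    and "open I" and "0 \<notin> I" and "\<And>y. y \<in> I \<Longrightarrow> 1 + chi1 \<epsilon> \<alpha> y \<noteq> 0"
    and "solves_ode_on \<epsilon> \<alpha> I chi2"
    and "\<And>p. p \<in> domD \<Longrightarrow> p $ 1 - p $ 0 \<in> I \<Longrightarrow> has_frame_coefficients \<epsilon> \<alpha> chi2 g p"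
  shows "\<forall>p\<in>domD. p $ 1 - p $ 0 \<in> I \<longrightarrow> wave_coordinate_condition g p"
proof (intro ballI impI)
  fix p assume p: "p \<in> domD" "p $ 1 - p $ 0 \<in> I"
  \<comment> \<open>The coefficients of \<open>g\<close> are prescribed only on \<open>U\<close>;
    differentiating them at \<open>p\<close> requires \<open>U\<close> to be a neighbourhood of
    \<open>p\<close>.\<close>
  define U where "U = domD \<inter> (\<lambda>q. q $ 1 - q $ 0) -` I"
  have "open U"
    unfolding U_def by (intro open_Int open_domD open_vimage \<open>open I\<close> continuous_intros)
  have "p \<in> U" using p by (simp add: U_def)
  let ?N = "\<lambda>q. let y = q $ 1 - q $ 0 in coord_inverse (q $ 0 * chi2 y / 4)
    (chi1A \<epsilon> \<alpha> 2 y) (chi1A \<epsilon> \<alpha> 3 y) (q $ 2 * chi2 y / 8) (q $ 3 * chi2 y / 8)"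
  have N_eq: "?N q $ i $ j
      = sqrt \<bar>det (metric_matrix g q)\<bar> * matrix_inv (metric_matrix g q) $ i $ j"
    if "q \<in> U" for q i j
  proof -
    have q: "q \<in> domD" "q $ 1 - q $ 0 \<in> I" using that by (auto simp: U_def)
    then have inv: "chi1A \<epsilon> \<alpha> 2 (q $ 1 - q $ 0) * chi1A \<epsilon> \<alpha> 3 (q $ 1 - q $ 0) = 1"
      using assms(6) by (simp add: chi1A_def)
    show ?thesis
      using metric_matrix_eq_coord_metric[OF assms(8)[OF q]] det_coord_metric[OF inv]
        matrix_inv_eqI[OF coord_metric_mult_inverse[OF inv]]
      by (simp add: Let_def)
  qed
  define y where "y = p $ 1 - p $ 0"
  \<comment> \<open>These keep \<open>y\<close> off the logarithmic singularity and make the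
    reciprocal defining \<open>chi1A\<close> at index 3 differentiable.\<close>
  have "y \<noteq> 0" "1 + chi1 \<epsilon> \<alpha> y \<noteq> 0" using p assms(5,6) by (auto simp: y_def)
  obtain c' where c': "(chi2 has_real_derivative c') (at y)"
    using assms(7) p by (auto simp: solves_ode_on_def y_def real_differentiable_def)
  obtain D where D: "(chi1 \<epsilon> \<alpha> has_real_derivative D) (at y)"
    using chi1_differentiable[of \<alpha> y] \<open>1/4 < \<alpha>\<close> \<open>y \<noteq> 0\<close> by (auto simp: real_differentiable_def)
  have a': "(chi1A \<epsilon> \<alpha> 2 has_real_derivative D) (at y)"
    using D unfolding chi1A_def[abs_def] by (auto intro!: derivative_eq_intros)
  have b': "(chi1A \<epsilon> \<alpha> 3 has_real_derivative - D / (1 + chi1 \<epsilon> \<alpha> y)\<^sup>2) (at y)"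
    using D \<open>1 + chi1 \<epsilon> \<alpha> y \<noteq> 0\<close> unfolding chi1A_def[abs_def]
    by (auto intro!: derivative_eq_intros simp: power2_eq_square)
  show "wave_coordinate_condition g p"
    unfolding wave_coordinate_condition_def
  proof
    fix j
    obtain d where d: "\<And>i. has_partial_derivative (\<lambda>q. ?N q $ i $ j) i (d i) p" "(\<Sum>i\<in>UNIV. d i) = 0"
      using divergence_coord_inverse[OF a'[unfolded y_def] b'[unfolded y_def] c'[unfolded y_def], of j]
      by (auto simp: Let_def)
    have "has_partial_derivative
        (\<lambda>q. sqrt \<bar>det (metric_matrix g q)\<bar> * matrix_inv (metric_matrix g q) $ i $ j) i (d i) p" for i
      by (rule has_partial_derivative_transform_open[OF d(1) \<open>open U\<close> \<open>p \<in> U\<close> N_eq])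
    with d(2) show "\<exists>d. (\<forall>i. has_partial_derivative
        (\<lambda>q. sqrt \<bar>det (metric_matrix g q)\<bar> * matrix_inv (metric_matrix g q) $ i $ j) i (d i) p) \<and>
        (\<Sum>i\<in>UNIV. d i) = 0"
      by blast
  qed
qed

end
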